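(* Let $X$ be a Banach space. Let $X$ have a fundamental minimal system $\{x_i\}_{i\in I}$ or $\operatorname{dens} X=\aleph_1$. Then suitable models generate nice rich families in $X$.
   Context: Banach spaces are over the real numbers. "Countable" means finite or countably infinite. $\operatorname{dens}X$ is the density of $X$ (least cardinality of a dense subset). Fundamental minimal system. For vectors $\{x_i\}_{i\in I}$ in $X$, $[x_i;\ i\in I]$ is their closed linear hull. The family is a fundamental minimal system if $[x_i;\ i\in I]=X$ and $x_i\notin[x_j;\ j\in I,\ j\ne i]$ for every $i\in I$. Rich families. A family $\mathcal F$ of separable subspaces of a Banach space $X$ is called rich if (1) each separable subspace of $X$ is contained in an element of $\mathcal F$, and (2) for every increasing sequence $(F_i)_{i\ge 1}$ in $\mathcal F$, $\overline{\bigcup_{i=1}^\infty F_i}$ belongs to $\mathcal F$. Suitable models. Formulas are formulas of the language of set theory (ZFC). For a set $N$ and a formula $\varphi$, the relativization $\varphi^N$ is obtained by replacing each quantifier "$\forall x$" by "$\forall x\in N$" and each "$\exists x$" by "$\exists x\in N$". A formula $\varphi(x_1,\dots,x_n)$ (all free variables shown) is absolute for $N$ if for all $a_1,\dots,a_n\in N$, $\varphi^N(a_1,\dots,a_n)\leftrightarrow\varphi(a_1,\dots,a_n)$. For a finite list of formulas $\varphi_1,\dots,\varphi_n$ and a countable set $Y$, we write $M\prec(\varphi_1,\dots,\varphi_n;Y)$ if $M\supset Y$ is a countable set such that $\varphi_1,\dots,\varphi_n$ are absolute for $M$. For a topological space $X$ and such $M$, $X_M:=\overline{X\cap M}$. "Suitable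 models generate nice rich families in $X$" means: whenever $Y$ is a countable set and $\varphi_1,\dots,\varphi_n$ is a list of formulas, there exists a family $\mathcal M$ such that (i) for every $M\in\mathcal M$, $M\prec(\varphi_1,\dots,\varphi_n;Y)$; (ii) the set $\{X_M;\ M\in\mathcal M\}$ is a rich family of separable subspaces in $X$; (iii) for all $M,N\in\mathcal M$: $M\subset N\Longleftrightarrow\overline{X\cap M}\subset\overline{X\cap N}$. *)

theory Defs
  imports "HOL-Analysis.Analysis"
begin

unbundle cardinal_syntax

text \<open>
  The type \<open>'v\<close> with the relation \<open>E\<close> (\<open>E x a\<close> means ``\<open>x\<close> is an element of \<open>a\<close>'') plays the role of
  the universe of all sets. Separation and replacement are stated for arbitrary predicates and
  functions of the logic. Hence every subcollection of a set is a set, and being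
  countable, having cardinality \<open>\<aleph>\<^sub>1\<close>, being a real Banach space, etc. mean the same inside the universe
  and in the surrounding logic.
\<close>

definition elts :: "('v \<Rightarrow> 'v \<Rightarrow> bool) \<Rightarrow> 'v \<Rightarrow> 'v set" where
  "elts E a = {x. E x a}"

locale zfc_universe =
  fixes E :: "'v \<Rightarrow> 'v \<Rightarrow> bool"
  assumes extensionality: "elts E a = elts E b \<Longrightarrow> a = b"
    and foundation: "elts E a \<noteq> {} \<Longrightarrow> \<exists>x\<in>elts E a. elts E x \<inter> elts E a = {}"
    and pairing: "\<exists>c. elts E c = {a, b}"
    and union: "\<exists>u. elts E u = (\<Union>x\<in>elts E a. elts E x)"
    and powerset: "\<exists>p. elts E p = {x. elts E x \<subseteq> elts E a}"
    and infinity: "\<exists>w. (\<exists>z\<in>elts E w. elts E z = {}) \<and>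
                       (\<forall>x\<in>elts E w. \<exists>y\<in>elts E w. elts E y = insert x (elts E x))"
    and separation: "\<exists>b. elts E b = {x \<in> elts E a. P x}"
    and replacement: "\<exists>b. elts E b = f ` elts E a"
    and choice: "(\<And>x. x \<in> elts E a \<Longrightarrow> elts E x \<noteq> {}) \<Longrightarrow>
                 (\<And>x y. x \<in> elts E a \<Longrightarrow> y \<in> elts E a \<Longrightarrow> x \<noteq> y \<Longrightarrow> elts E x \<inter> elts E y = {}) \<Longrightarrow>
                 \<exists>c. \<forall>x\<in>elts E a. \<exists>!y. y \<in> elts E c \<inter> elts E x"

datatype fm =
    Mem nat nat
  | Eq nat nat
  | Neg fm
  | And fm fm
  | Or fm fm
  | Imp fm fm
  | Iff fm fm
  | All nat fm
  | Ex nat fm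

primrec fv :: "fm \<Rightarrow> nat set" where
  "fv (Mem i j) = {i, j}"
| "fv (Eq i j) = {i, j}"
| "fv (Neg \<phi>) = fv \<phi>"
| "fv (And \<phi> \<psi>) = fv \<phi> \<union> fv \<psi>"
| "fv (Or \<phi> \<psi>) = fv \<phi> \<union> fv \<psi>"
| "fv (Imp \<phi> \<psi>) = fv \<phi> \<union> fv \<psi>"
| "fv (Iff \<phi> \<psi>) = fv \<phi> \<union> fv \<psi>"
| "fv (All i \<phi>) = fv \<phi> - {i}"
| "fv (Ex i \<phi>) = fv \<phi> - {i}"

text \<open>
  \<open>holds_rel E N \<phi> s\<close> is the truth value of the relativization \<open>\<phi>\<^sup>N\<close> under the assignment \<open>s\<close>;
  \<open>holds E \<phi> s\<close> is the truth value of \<open>\<phi>\<close> itself, all quantifiers ranging over the whole universe.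
\<close>

primrec holds_rel :: "('v \<Rightarrow> 'v \<Rightarrow> bool) \<Rightarrow> 'v set \<Rightarrow> fm \<Rightarrow> (nat \<Rightarrow> 'v) \<Rightarrow> bool" where
  "holds_rel E N (Mem i j) s \<longleftrightarrow> E (s i) (s j)"
| "holds_rel E N (Eq i j) s \<longleftrightarrow> s i = s j"
| "holds_rel E N (Neg \<phi>) s \<longleftrightarrow> \<not> holds_rel E N \<phi> s"
| "holds_rel E N (And \<phi> \<psi>) s \<longleftrightarrow> holds_rel E N \<phi> s \<and> holds_rel E N \<psi> s"
| "holds_rel E N (Or \<phi> \<psi>) s \<longleftrightarrow> holds_rel E N \<phi> s \<or> holds_rel E N \<psi> s"
| "holds_rel E N (Imp \<phi> \<psi>) s \<longleftrightarrow> (holds_rel E N \<phi> s \<longrightarrow> holds_rel E N \<psi> s)"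
| "holds_rel E N (Iff \<phi> \<psi>) s \<longleftrightarrow> (holds_rel E N \<phi> s \<longleftrightarrow> holds_rel E N \<psi> s)"
| "holds_rel E N (All i \<phi>) s \<longleftrightarrow> (\<forall>a\<in>N. holds_rel E N \<phi> (s(i := a)))"
| "holds_rel E N (Ex i \<phi>) s \<longleftrightarrow> (\<exists>a\<in>N. holds_rel E N \<phi> (s(i := a)))"

definition holds :: "('v \<Rightarrow> 'v \<Rightarrow> bool) \<Rightarrow> fm \<Rightarrow> (nat \<Rightarrow> 'v) \<Rightarrow> bool" where
  "holds E \<phi> s \<longleftrightarrow> holds_rel E UNIV \<phi> s"

definition absolute_for :: "('v \<Rightarrow> 'v \<Rightarrow> bool) \<Rightarrow> 'v set \<Rightarrow> fm \<Rightarrow> bool" where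
  "absolute_for E N \<phi> \<longleftrightarrow>
     (\<forall>s. (\<forall>i\<in>fv \<phi>. s i \<in> N) \<longrightarrow> (holds_rel E N \<phi> s \<longleftrightarrow> holds E \<phi> s))"

definition suitable_model :: "('v \<Rightarrow> 'v \<Rightarrow> bool) \<Rightarrow> fm list \<Rightarrow> 'v \<Rightarrow> 'v \<Rightarrow> bool" where
  "suitable_model E \<phi>s Y M \<longleftrightarrow>
     elts E Y \<subseteq> elts E M \<and> countable (elts E M) \<and> (\<forall>\<phi>\<in>set \<phi>s. absolute_for E (elts E M) \<phi>)"

definition separable_subspace :: "'a::banach set \<Rightarrow> bool" where
  "separable_subspace S \<longleftrightarrow> subspace S \<and> closed S \<and> separable_space (top_of_set S)"

definition rich_family :: "'a::banach set set \<Rightarrow> bool" where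
  "rich_family \<F> \<longleftrightarrow>
     (\<forall>F\<in>\<F>. separable_subspace F) \<and>
     (\<forall>S. separable_subspace S \<longrightarrow> (\<exists>F\<in>\<F>. S \<subseteq> F)) \<and>
     (\<forall>F :: nat \<Rightarrow> 'a set. incseq F \<longrightarrow> range F \<subseteq> \<F> \<longrightarrow> closure (\<Union>i. F i) \<in> \<F>)"

definition closed_hull :: "'a::banach set \<Rightarrow> 'a set" where
  "closed_hull A = closure (span A)"

definition fundamental_minimal_system :: "'i set \<Rightarrow> ('i \<Rightarrow> 'a::banach) \<Rightarrow> bool" where
  "fundamental_minimal_system I x \<longleftrightarrow>
     closed_hull (x ` I) = UNIV \<and> (\<forall>i\<in>I. x i \<notin> closed_hull (x ` (I - {i})))"

text \<open>\<open>r\<close> represents the least cardinality of a dense subset of the whole space.\<close>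

definition has_dens :: "'a::topological_space itself \<Rightarrow> 'c rel \<Rightarrow> bool" where
  "has_dens _ r \<longleftrightarrow>
     (\<exists>D :: 'a set. closure D = UNIV \<and> |D| =o r) \<and>
     (\<forall>D :: 'a set. closure D = UNIV \<longrightarrow> r \<le>o |D| )"

abbreviation aleph1 :: "nat set rel" where
  "aleph1 \<equiv> cardSuc natLeq"

text \<open>
  The underlying set of the Banach space \<open>'a\<close> is a set \<open>X\<close> of the universe; \<open>pt\<close> is the bijection that
  reads an element of \<open>X\<close> as a vector. The vectors belonging to \<open>X \<inter> M\<close> are thus
  \<open>pt ` (elts E X \<inter> elts E M)\<close>.
\<close>

definition model_subspace ::
  "('v \<Rightarrow> 'v \<Rightarrow> bool) \<Rightarrow> 'v \<Rightarrow> ('v \<Rightarrow> 'a::topological_space) \<Rightarrow> 'v \<Rightarrow> 'a set" where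
  "model_subspace E X pt M = closure (pt ` (elts E X \<inter> elts E M))"

definition suitable_models_generate_nice_rich_families ::
  "('v \<Rightarrow> 'v \<Rightarrow> bool) \<Rightarrow> 'v \<Rightarrow> ('v \<Rightarrow> 'a::banach) \<Rightarrow> bool" where
  "suitable_models_generate_nice_rich_families E X pt \<longleftrightarrow>
     (\<forall>Y \<phi>s. countable (elts E Y) \<longrightarrow>
       (\<exists>\<M>.
          (\<forall>M\<in>elts E \<M>. suitable_model E \<phi>s Y M) \<and>
          rich_family (model_subspace E X pt ` elts E \<M>) \<and>
          (\<forall>M\<in>elts E \<M>. \<forall>N\<in>elts E \<M>.
             elts E M \<subseteq> elts E N \<longleftrightarrow> model_subspace E X pt M \<subseteq> model_subspace E X pt N)))"

end

theory Submission
  imports Defs "HOL-Library.Countable_Set_Type"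
begin

text \<open>
  The two hypotheses on the space enter only through the following consequence. There is a set \<open>B\<close>
  of vectors with dense linear span and a map \<open>D\<close> assigning to every vector \<open>u\<close> a countable
  \<open>D u \<subseteq> B\<close> with \<open>u\<close> in the closed hull of \<open>D u\<close>, such that a subset \<open>A\<close> of \<open>B\<close> with \<open>D a \<subseteq> A\<close>
  for all \<open>a \<in> A\<close> can be recovered from its closed hull: it contains every element of \<open>B\<close> lying in
  that hull. For a fundamental minimal system \<open>B\<close> is the system itself, and every subset of \<open>B\<close> is
  recovered. If the density is \<open>\<aleph>\<^sub>1\<close>, well-order a dense set in type \<open>\<omega>\<^sub>1\<close> and keep in \<open>B\<close> those
  vectors that are not in the closed hull of their predecessors. The predecessors of \<open>b\<close> are put
  into \<open>D b\<close>, so that the sets \<open>A\<close> in question are initial segments of \<open>B\<close>.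

  Given \<open>B\<close> and \<open>D\<close>, consider sets closed under countably many finitary operations: Skolem functions
  for all formulas, constants for the elements of \<open>Y\<close>, the map \<open>D\<close>, and rational linear
  combinations. A closed \<open>N\<close> makes every formula absolute, contains \<open>Y\<close>, and satisfies
  \<open>X\<^sub>N = [B \<inter> N]\<close>. Take as models the countable \<open>N\<close> that are generated by their own part
  \<open>B \<inter> N\<close>. Then \<open>X\<^sub>M \<subseteq> X\<^sub>N\<close> forces \<open>B \<inter> M \<subseteq> B \<inter> N\<close> by the recovery property, hence \<open>M \<subseteq> N\<close>.
  Richness holds because this class of models is closed under unions of increasing sequences, and
  because for every countable closed \<open>M\<close> the hull \<open>N\<close> of \<open>B \<inter> M\<close> is such a model with
  \<open>B \<inter> N = B \<inter> M\<close>, hence with \<open>X\<^sub>N = X\<^sub>M\<close>.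

  All these models are subsets of the hull of \<open>X\<close>. That hull is a set by replacement and union, so
  the models form a set.
\<close>

section \<open>Generating sets with subsystems determined by their closed hulls\<close>

text \<open>
  The map \<open>(r, u, v) \<mapsto> r u + v\<close> is continuous and \<open>\<rat>\<close> is dense, so closedness under rational
  combinations passes to real combinations in the closure.
\<close>

lemma subspace_closure_rational:
  fixes V :: "'a::real_normed_vector set"
  assumes zero: "0 \<in> V" and lin: "\<And>q u v. q \<in> \<rat> \<Longrightarrow> u \<in> V \<Longrightarrow> v \<in> V \<Longrightarrow> q *\<^sub>R u + v \<in> V"
  shows "subspace (closure V)"
proof -
  define f where "f = (\<lambda>(r::real, u::'a, v). r *\<^sub>R u + v)"
  have "f ` closure (\<rat> \<times> V \<times> V) \<subseteq> closure V"
  proof (rule image_closure_subset)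
    show "continuous_on (closure (\<rat> \<times> V \<times> V)) f"
      unfolding f_def case_prod_unfold by (intro continuous_intros)
    show "f ` (\<rat> \<times> V \<times> V) \<subseteq> closure V"
      using lin closure_subset[of V] by (auto simp: f_def)
  qed simp
  then have lin': "r *\<^sub>R u + v \<in> closure V" if "u \<in> closure V" "v \<in> closure V" for r u v
    using that by (force simp: f_def closure_Times Rats_closure_real image_subset_iff)
  have "0 \<in> closure V" using zero closure_subset by blast
  then show ?thesis
    unfolding subspace_def using lin'[where r = 1] lin'[where v = 0] by auto
qed

lemma closed_hull_mono: "A \<subseteq> B \<Longrightarrow> closed_hull A \<subseteq> closed_hull B"
  unfolding closed_hull_def by (intro closure_mono span_mono)

lemma closed_hull_superset: "A \<subseteq> closed_hull A"
  unfolding closed_hull_def using span_superset closure_subset by blast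

lemma closed_hull_minimal: "A \<subseteq> S \<Longrightarrow> subspace S \<Longrightarrow> closed S \<Longrightarrow> closed_hull A \<subseteq> S"
  unfolding closed_hull_def by (intro closure_minimal span_minimal)

lemma subspace_closed_hull: "subspace (closed_hull A)"
  unfolding closed_hull_def by (intro subspace_closure_rational span_zero span_add span_scale)

lemma closed_closed_hull: "closed (closed_hull A)"
  unfolding closed_hull_def by simp

text \<open>
  A vector in the closed hull is the limit of a sequence of finite linear combinations, which
  together involve only countably many generators.
\<close>

lemma closed_hull_countable_support:
  fixes B :: "'a::banach set"
  assumes "u \<in> closed_hull B"
  shows "\<exists>C\<subseteq>B. countable C \<and> u \<in> closed_hull C"
proof -
  obtain s where s: "\<And>n::nat. s n \<in> span B" "s \<longlonglongrightarrow> u"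
    using assms unfolding closed_hull_def closure_sequential by blast
  have "\<exists>T. finite T \<and> T \<subseteq> B \<and> s n \<in> span T" for n
    using s(1)[of n] unfolding span_explicit by blast
  then obtain T where T: "\<And>n. finite (T n)" "\<And>n. T n \<subseteq> B" "\<And>n. s n \<in> span (T n)"
    by metis
  have "s n \<in> span (\<Union>n. T n)" for n
    using T(3)[of n] span_mono[of "T n" "\<Union>n. T n"] by blast
  then have "u \<in> closed_hull (\<Union>n. T n)"
    unfolding closed_hull_def closure_sequential using s(2) by blast
  moreover have "countable (\<Union>n. T n)"
    using T(1) by (simp add: countable_finite)
  ultimately show ?thesis using T(2) by blast
qed

text \<open>
  The second conjunct is the recovery property: a \<open>D\<close>-closed part of \<open>B\<close> is determined by its closed
  hull. It is a weakening of minimality that can also be achieved in every space of density \<open>\<aleph>\<^sub>1\<close>.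
\<close>

definition dependency_system :: "'a::banach set \<Rightarrow> ('a \<Rightarrow> 'a set) \<Rightarrow> bool" where
  "dependency_system B D \<longleftrightarrow>
     (\<forall>u. countable (D u) \<and> D u \<subseteq> B \<and> u \<in> closed_hull (D u)) \<and>
     (\<forall>A\<subseteq>B. (\<forall>a\<in>A. D a \<subseteq> A) \<longrightarrow> B \<inter> closed_hull A \<subseteq> A)"

text \<open>
  It suffices to have a map \<open>P\<close> that achieves the recovery property: enlarging \<open>P\<close> by countable
  supports only reduces the collection of sets to be recovered.
\<close>

lemma dependency_systemI:
  fixes B :: "'a::banach set"
  assumes gen: "closed_hull B = UNIV"
    and P: "\<And>b. b \<in> B \<Longrightarrow> countable (P b) \<and> P b \<subseteq> B"
    and indep: "\<And>A b. A \<subseteq> B \<Longrightarrow> (\<And>a. a \<in> A \<Longrightarrow> P a \<subseteq> A) \<Longrightarrow> b \<in> B \<Longrightarrow> b \<notin> A \<Longrightarrow> b \<notin> closed_hull A"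
  shows "\<exists>D. dependency_system B D"
proof -
  have "\<forall>u. \<exists>C\<subseteq>B. countable C \<and> u \<in> closed_hull C"
    using closed_hull_countable_support[of _ B] gen by simp
  then obtain C where C: "\<And>u. C u \<subseteq> B" "\<And>u. countable (C u)" "\<And>u. u \<in> closed_hull (C u)"
    by metis
  define D where "D u = C u \<union> (if u \<in> B then P u else {})" for u
  have "countable (D u) \<and> D u \<subseteq> B \<and> u \<in> closed_hull (D u)" for u
    using C[of u] P[of u] closed_hull_mono[of "C u" "D u"] by (auto simp: D_def)
  moreover have "B \<inter> closed_hull A \<subseteq> A" if A: "A \<subseteq> B" "\<forall>a\<in>A. D a \<subseteq> A" for A
  proof -
    have "\<And>a. a \<in> A \<Longrightarrow> P a \<subseteq> A"
      using A unfolding D_def by fastforce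
    then show ?thesis using indep[OF A(1)] by blast
  qed
  ultimately show ?thesis
    unfolding dependency_system_def by blast
qed

lemma dependency_system_minimal_system:
  assumes "fundamental_minimal_system I x"
  shows "\<exists>D. dependency_system (x ` I) D"
proof (rule dependency_systemI[where P = "\<lambda>_. {}"])
  show "closed_hull (x ` I) = UNIV"
    using assms by (simp add: fundamental_minimal_system_def)
  fix A b
  assume A: "A \<subseteq> x ` I" and b: "b \<in> x ` I" "b \<notin> A"
  from b obtain i where i: "i \<in> I" "b = x i" by blast
  have "A \<subseteq> x ` I - {x i}" using A b(2) i(2) by auto
  also have "\<dots> \<subseteq> x ` (I - {i})" by auto
  finally have "closed_hull A \<subseteq> closed_hull (x ` (I - {i}))" by (rule closed_hull_mono)
  moreover have "x i \<notin> closed_hull (x ` (I - {i}))"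
    using assms i(1) by (simp add: fundamental_minimal_system_def)
  ultimately show "b \<notin> closed_hull A" using i(2) by auto
qed auto

text \<open>
  In a well-order of type \<open>\<omega>\<^sub>1\<close> all proper initial segments are countable, so predecessors are
  admissible dependencies. Discarding from a dense set the vectors in the closed hull of their
  predecessors keeps the closed hull (by induction along the order). If \<open>A\<close> is an initial segment
  of what remains and \<open>b \<notin> A\<close>, then \<open>A\<close> consists of predecessors of \<open>b\<close>, and so \<open>b\<close> is not in its
  hull.
\<close>

lemma dependency_system_dens_aleph1:
  assumes "has_dens TYPE('a::banach) aleph1"
  shows "\<exists>(B::'a set) D. dependency_system B D"
proof -
  obtain S :: "'a set" where S: "closure S = UNIV" "|S| =o aleph1"
    using assms unfolding has_dens_def by blast
  define r where "r = |S|"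
  have fld: "Field r = S"
    unfolding r_def by (rule Field_card_of)
  have wo: "Well_order r"
    unfolding r_def by (rule card_of_Well_order)
  have cnt: "countable (underS r d)" if "d \<in> S" for d
  proof -
    have "|underS r d| <o r"
      using card_of_underS[of r d] card_of_Card_order[of S] that fld unfolding r_def by blast
    then have "|underS r d| <o aleph1"
      using S(2) ordLess_ordIso_trans r_def by blast
    then have "|underS r d| \<le>o natLeq"
      by (simp add: natLeq_Card_order card_of_Card_order cardSuc_ordLeq_ordLess)
    then show ?thesis by (simp add: countable_card_le_natLeq)
  qed
  define B where "B = {d \<in> S. d \<notin> closed_hull (underS r d)}"
  have wf: "wf (r - Id)" using wo by (simp add: well_order_on_def)
  have S_hull: "d \<in> S \<longrightarrow> d \<in> closed_hull B" for d
  proof (induction d rule: wf_induct_rule[OF wf])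
    case (1 d)
    show ?case
    proof
      assume d: "d \<in> S"
      have "underS r d \<subseteq> closed_hull B"
        using 1 fld by (auto simp: underS_def Field_def)
      then have "closed_hull (underS r d) \<subseteq> closed_hull B"
        by (intro closed_hull_minimal subspace_closed_hull closed_closed_hull)
      then show "d \<in> closed_hull B"
        using d closed_hull_superset[of B] unfolding B_def by blast
    qed
  qed
  have "closure S \<subseteq> closed_hull B"
    using S_hull by (intro closure_minimal closed_closed_hull) blast
  then have "closed_hull B = UNIV" using S(1) by blast
  moreover have "countable (underS r b \<inter> B) \<and> underS r b \<inter> B \<subseteq> B" if "b \<in> B" for b
    using cnt[of b] that unfolding B_def by auto
  moreover have "b \<notin> closed_hull A"
    if A: "A \<subseteq> B" "\<And>a. a \<in> A \<Longrightarrow> underS r a \<inter> B \<subseteq> A" and b: "b \<in> B" "b \<notin> A" for A b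
  proof -
    have "A \<subseteq> underS r b"
    proof
      fix a assume a: "a \<in> A"
      have "a \<noteq> b" "a \<in> Field r" "b \<in> Field r" using a b A fld unfolding B_def by auto
      moreover have "total_on (Field r) r"
        using wo by (simp add: well_order_on_def linear_order_on_def)
      ultimately have "(a, b) \<in> r \<or> (b, a) \<in> r" by (simp add: total_on_def)
      moreover have "(b, a) \<notin> r"
        using A(2)[OF a] b \<open>a \<noteq> b\<close> by (auto simp: underS_def)
      ultimately show "a \<in> underS r b" using \<open>a \<noteq> b\<close> by (simp add: underS_def)
    qed
    then show ?thesis
      using b(1) closed_hull_mono[of A "underS r b"] unfolding B_def by blast
  qed
  ultimately show ?thesis
    using dependency_systemI[of B "\<lambda>b. underS r b \<inter> B"] by blast
qed

section \<open>Hulls under countably many finitary operations\<close>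

text \<open>
  A list-indexed \<open>H\<close> with countable values encodes countably many operations of every finite arity
  at once; the values at the empty list are constants.
\<close>

inductive_set fhull :: "('v list \<Rightarrow> 'v set) \<Rightarrow> 'v set \<Rightarrow> 'v set" for H A where
  base: "a \<in> A \<Longrightarrow> a \<in> fhull H A"
| step: "xs \<in> lists (fhull H A) \<Longrightarrow> y \<in> H xs \<Longrightarrow> y \<in> fhull H A"
monos lists_mono

definition fclosed :: "('v list \<Rightarrow> 'v set) \<Rightarrow> 'v set \<Rightarrow> bool" where
  "fclosed H N \<longleftrightarrow> (\<forall>xs\<in>lists N. H xs \<subseteq> N)"

lemma fclosed_fhull: "fclosed H (fhull H A)"
  unfolding fclosed_def by (intro ballI subsetI) (rule fhull.step)

lemma fhull_superset: "A \<subseteq> fhull H A"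
  by (rule subsetI) (rule fhull.base)

lemma fhull_minimal: "A \<subseteq> N \<Longrightarrow> fclosed H N \<Longrightarrow> fhull H A \<subseteq> N"
proof
  fix y assume N: "A \<subseteq> N" "fclosed H N" and "y \<in> fhull H A"
  from this(3) show "y \<in> N"
  proof induction
    case (step xs y)
    have "xs \<in> lists N" using step(1) by (auto simp: lists_eq_set)
    then show ?case using step(2) N(2) by (auto simp: fclosed_def)
  qed (use N in auto)
qed

lemma fhull_mono: "A \<subseteq> B \<Longrightarrow> fhull H A \<subseteq> fhull H B"
  by (meson fclosed_fhull fhull_minimal fhull_superset order_trans)

lemma lists_UN_incseq:
  assumes "incseq N" "xs \<in> lists (\<Union>n. N n)"
  shows "\<exists>n::nat. xs \<in> lists (N n)"
  using assms(2)
proof (induction xs)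
  case (Cons x xs)
  then obtain m n where mn: "x \<in> N m" "xs \<in> lists (N n)" by auto
  have "x \<in> N (max m n)" "xs \<in> lists (N (max m n))"
    using mn incseqD[OF assms(1), of m "max m n"] incseqD[OF assms(1), of n "max m n"]
    by (auto simp: lists_eq_set)
  then show ?case by auto
qed auto

lemma fclosed_UN_incseq:
  assumes "incseq N" "\<And>n::nat. fclosed H (N n)"
  shows "fclosed H (\<Union>n. N n)"
  unfolding fclosed_def
proof
  fix xs assume "xs \<in> lists (\<Union>n. N n)"
  then obtain n where "xs \<in> lists (N n)" using lists_UN_incseq[OF assms(1)] by blast
  then have "H xs \<subseteq> N n" using assms(2) unfolding fclosed_def by blast
  then show "H xs \<subseteq> (\<Union>n. N n)" by blast
qed

text \<open>
  The hull is reached in \<open>\<omega>\<close> stages since the operations are finitary. Bounds on its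
  size, both by countability and by being a set of the universe, are proved stage by stage.
\<close>

lemma fhull_eq_UN:
  "fhull H A = (\<Union>n. ((\<lambda>S. S \<union> (\<Union>xs\<in>lists S. H xs)) ^^ n) A)"
proof -
  define L where "L n = ((\<lambda>S. S \<union> (\<Union>xs\<in>lists S. H xs)) ^^ n) A" for n :: nat
  have L: "L 0 = A" "\<And>n. L (Suc n) = L n \<union> (\<Union>xs\<in>lists (L n). H xs)"
    by (simp_all add: L_def)
  have inc: "incseq L" by (rule incseq_SucI) (simp add: L)
  have "fclosed H (\<Union>n. L n)"
    unfolding fclosed_def
  proof
    fix xs assume "xs \<in> lists (\<Union>n. L n)"
    then obtain n where "xs \<in> lists (L n)" using lists_UN_incseq[OF inc] by blast
    then have "H xs \<subseteq> L (Suc n)" by (auto simp: L)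
    then show "H xs \<subseteq> (\<Union>n. L n)" by blast
  qed
  then have "fhull H A \<subseteq> (\<Union>n. L n)" using L(1) by (intro fhull_minimal) auto
  moreover have "L n \<subseteq> fhull H A" for n
  proof (induction n)
    case (Suc n)
    then show ?case using fclosed_fhull[of H A] lists_mono[OF Suc]
      unfolding L fclosed_def by blast
  qed (simp add: L fhull_superset)
  ultimately show ?thesis unfolding L_def by blast
qed

lemma countable_fhull:
  assumes "\<And>xs. countable (H xs)" "countable A"
  shows "countable (fhull H A)"
proof -
  have "countable (((\<lambda>S. S \<union> (\<Union>xs\<in>lists S. H xs)) ^^ n) A)" for n :: nat
    by (induction n) (use assms in auto)
  then show ?thesis unfolding fhull_eq_UN by simp
qed

section \<open>Small classes\<close>

text \<open>
  Models must be elements of the universe and not merely predicates on it, so one has to know which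
  classes arise from sets.
\<close>

definition small :: "('v \<Rightarrow> 'v \<Rightarrow> bool) \<Rightarrow> 'v set \<Rightarrow> bool" where
  "small E A \<longleftrightarrow> (\<exists>a. elts E a = A)"

context zfc_universe
begin

lemma small_elts: "small E (elts E a)"
  by (auto simp: small_def)

lemma small_subset: "small E A \<Longrightarrow> B \<subseteq> A \<Longrightarrow> small E B"
proof -
  assume "small E A" "B \<subseteq> A"
  then obtain a where "elts E a = A" by (auto simp: small_def)
  moreover obtain b where "elts E b = {y \<in> elts E a. y \<in> B}"
    by (rule exE[OF separation[of a "\<lambda>y. y \<in> B"]])
  ultimately show ?thesis using \<open>B \<subseteq> A\<close> by (auto simp: small_def intro!: exI[of _ b])
qed

lemma small_image: "small E A \<Longrightarrow> small E (f ` A)"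
  unfolding small_def using replacement[of f] by blast

lemma small_UN:
  assumes "small E A" "\<And>a. a \<in> A \<Longrightarrow> small E (F a)"
  shows "small E (\<Union>a\<in>A. F a)"
proof -
  obtain c where c: "\<And>a. a \<in> A \<Longrightarrow> elts E (c a) = F a"
    using assms(2) unfolding small_def by metis
  obtain b where "elts E b = c ` A" using small_image[OF assms(1), of c] by (auto simp: small_def)
  moreover obtain u where "elts E u = (\<Union>y\<in>elts E b. elts E y)"
    by (rule exE[OF union[of b]])
  ultimately have "elts E u = (\<Union>a\<in>A. F a)" using c by auto
  then show ?thesis by (auto simp: small_def)
qed

text \<open>
  Foundation makes membership well-founded on the set \<open>w\<close> given by infinity. If \<open>w\<close> were finite, the
  converse relation would be well-founded too, and \<open>w\<close> would have a member belonging to no other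
  member, whereas the successor of that member is again in \<open>w\<close>.
\<close>

lemma infinite_set_exists: "\<exists>w. infinite (elts E w)"
proof -
  obtain w where "(\<exists>z\<in>elts E w. elts E z = {}) \<and>
      (\<forall>y\<in>elts E w. \<exists>z\<in>elts E w. elts E z = insert y (elts E y))"
    by (rule exE[OF infinity])
  then have w: "\<exists>z. z \<in> elts E w"
      "\<And>y. y \<in> elts E w \<Longrightarrow> \<exists>z\<in>elts E w. elts E z = insert y (elts E y)"
    by auto
  define R where "R = {(y, z). y \<in> elts E w \<and> z \<in> elts E w \<and> E y z}"
  have "wf R"
  proof (rule wfI_min)
    fix y Q assume y: "y \<in> (Q :: 'v set)"
    show "\<exists>z\<in>Q. \<forall>t. (t, z) \<in> R \<longrightarrow> t \<notin> Q"
    proof (cases "y \<in> elts E w")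
      case True
      obtain q where q: "elts E q = {z \<in> elts E w. z \<in> Q}"
        by (rule exE[OF separation[of w "\<lambda>z. z \<in> Q"]])
      then have "elts E q \<noteq> {}" using True y by auto
      then obtain z where "z \<in> elts E q" "elts E z \<inter> elts E q = {}"
        using foundation[of q] by blast
      then show ?thesis using q by (intro bexI[of _ z]) (auto simp: R_def elts_def)
    qed (use y in \<open>auto simp: R_def\<close>)
  qed
  have "infinite (elts E w)"
  proof
    assume fin: "finite (elts E w)"
    have "finite R" by (rule finite_subset[of _ "elts E w \<times> elts E w"]) (use fin in \<open>auto simp: R_def\<close>)
    then have "wf (R\<inverse>)" using \<open>wf R\<close> by (simp add: finite_acyclic_wf_converse wf_acyclic)
    moreover obtain z0 where "z0 \<in> elts E w" using w(1) by blast
    ultimately obtain m where m: "m \<in> elts E w" "\<And>t. (t, m) \<in> R\<inverse> \<Longrightarrow> t \<notin> elts E w"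
      using wfE_min[of "R\<inverse>" z0 "elts E w"] by blast
    obtain z where "z \<in> elts E w" "m \<in> elts E z" using w(2)[OF m(1)] by blast
    then show False using m by (auto simp: R_def elts_def)
  qed
  then show ?thesis by blast
qed

text \<open>
  Every countable class is contained in an image of an infinite set, hence is a set by replacement
  and separation.
\<close>

lemma small_countable:
  assumes "countable A"
  shows "small E A"
proof -
  obtain w where w: "infinite (elts E w)" using infinite_set_exists by blast
  then obtain f :: "nat \<Rightarrow> 'v" where f: "inj f" "range f \<subseteq> elts E w"
    using infinite_countable_subset by blast
  have "A \<subseteq> (\<lambda>v. from_nat_into A (inv f v)) ` elts E w"
  proof
    fix a assume "a \<in> A"
    then have "a = from_nat_into A (inv f (f (to_nat_on A a)))"
      using assms f(1) by simp
    then show "a \<in> (\<lambda>v. from_nat_into A (inv f v)) ` elts E w" using f(2) by blast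
  qed
  then show ?thesis using small_subset small_image small_elts by blast
qed

lemma small_Un: "small E A \<Longrightarrow> small E B \<Longrightarrow> small E (A \<union> B)"
proof -
  assume A: "small E A" and B: "small E B"
  then obtain a b where ab: "elts E a = A" "elts E b = B" by (auto simp: small_def)
  have "small E (\<Union>c\<in>{a, b}. elts E c)"
    by (intro small_UN small_countable small_elts) simp
  then show ?thesis using ab by simp
qed

lemma small_UN_nat:
  assumes "\<And>n::nat. small E (F n)"
  shows "small E (\<Union>n. F n)"
proof -
  obtain c where c: "\<And>n. elts E (c n) = F n" using assms unfolding small_def by metis
  have "small E (\<Union>a\<in>range c. elts E a)"
    by (intro small_UN small_countable small_elts) simp
  then show ?thesis using c by simp
qed

text \<open>
  Lists over \<open>'v\<close> are not elements of the universe, so the union is not indexed by a set. For a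
  fixed length it is an iterated set-indexed union.
\<close>

lemma small_UN_lists:
  assumes A: "small E A" and H: "\<And>xs. small E (H xs)"
  shows "small E (\<Union>xs\<in>lists A. H xs)"
proof -
  have len: "small E (\<Union>xs\<in>{xs \<in> lists A. length xs = n}. H xs)" if "\<And>xs. small E (H xs)" for H n
    using that
  proof (induction n arbitrary: H)
    case 0
    have "{xs \<in> lists A. length xs = 0} = {[]}" by auto
    then show ?case using 0 by simp
  next
    case (Suc n)
    have "(\<Union>xs\<in>{xs \<in> lists A. length xs = Suc n}. H xs)
        = (\<Union>a\<in>A. \<Union>xs\<in>{xs \<in> lists A. length xs = n}. H (a # xs))"
    proof -
      have "{xs \<in> lists A. length xs = Suc n} = (\<Union>a\<in>A. (#) a ` {xs \<in> lists A. length xs = n})"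
        by (force simp: length_Suc_conv)
      then show ?thesis by simp
    qed
    also have "small E \<dots>" by (intro small_UN A Suc.IH Suc.prems)
    finally show ?case .
  qed
  have "(\<Union>xs\<in>lists A. H xs) = (\<Union>n. \<Union>xs\<in>{xs \<in> lists A. length xs = n}. H xs)" by blast
  also have "small E \<dots>" by (intro small_UN_nat len H)
  finally show ?thesis .
qed

lemma small_fhull:
  assumes "\<And>xs. small E (H xs)" "small E A"
  shows "small E (fhull H A)"
proof -
  have "small E (((\<lambda>S. S \<union> (\<Union>xs\<in>lists S. H xs)) ^^ n) A)" for n :: nat
    by (induction n) (use assms in \<open>auto intro!: small_Un small_UN_lists\<close>)
  then show ?thesis unfolding fhull_eq_UN by (intro small_UN_nat)
qed

lemma small_Pow: "small E R \<Longrightarrow> small E {m. elts E m \<subseteq> R}"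
proof -
  assume "small E R"
  then obtain a where "elts E a = R" by (auto simp: small_def)
  then show ?thesis unfolding small_def using powerset[of a] by simp
qed

end

section \<open>Skolem witnesses\<close>

instance fm :: countable by countable_datatype

lemma finite_fv: "finite (fv \<phi>)"
  by (induction \<phi>) auto

lemma holds_rel_cong:
  "(\<And>i. i \<in> fv \<phi> \<Longrightarrow> s i = t i) \<Longrightarrow> holds_rel E N \<phi> s \<longleftrightarrow> holds_rel E N \<phi> t"
proof (induction \<phi> arbitrary: s t)
  case (All i \<phi>)
  have "holds_rel E N \<phi> (s(i := a)) \<longleftrightarrow> holds_rel E N \<phi> (t(i := a))" for a
    by (rule All.IH) (use All.prems in auto)
  then show ?case by simp
next
  case (Ex i \<phi>)
  have "holds_rel E N \<phi> (s(i := a)) \<longleftrightarrow> holds_rel E N \<phi> (t(i := a))" for a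
    by (rule Ex.IH) (use Ex.prems in auto)
  then show ?case by simp
next
  case (And \<phi> \<psi>)
  show ?case using And.IH(1)[of s t] And.IH(2)[of s t] And.prems by simp
next
  case (Or \<phi> \<psi>)
  show ?case using Or.IH(1)[of s t] Or.IH(2)[of s t] Or.prems by simp
next
  case (Imp \<phi> \<psi>)
  show ?case using Imp.IH(1)[of s t] Imp.IH(2)[of s t] Imp.prems by simp
next
  case (Iff \<phi> \<psi>)
  show ?case using Iff.IH(1)[of s t] Iff.IH(2)[of s t] Iff.prems by simp
next
  case (Neg \<phi>)
  show ?case using Neg.IH[of s t] Neg.prems by simp
qed auto

definition list_assignment :: "'v list \<Rightarrow> nat \<Rightarrow> 'v" where
  "list_assignment xs n = (if n < length xs then xs ! n else undefined)"

definition witness :: "('v \<Rightarrow> 'v \<Rightarrow> bool) \<Rightarrow> fm \<Rightarrow> nat \<Rightarrow> 'v list \<Rightarrow> 'v" where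
  "witness E \<psi> i xs = (SOME a. holds E \<psi> ((list_assignment xs)(i := a)))"

definition witnesses :: "('v \<Rightarrow> 'v \<Rightarrow> bool) \<Rightarrow> 'v list \<Rightarrow> 'v set" where
  "witnesses E xs = range (\<lambda>(\<psi>, i). witness E \<psi> i xs)"

lemma countable_witnesses: "countable (witnesses E xs)"
  unfolding witnesses_def by blast

text \<open>
  This is the Tarski-Vaught condition. A finite list suffices to encode \<open>s\<close> because only its values
  at the finitely many free variables matter. The other entries of the list are filled with some
  element of \<open>N\<close>, which exists since \<open>N\<close> is closed under the operations on the empty list.
\<close>

lemma witness_in_closed_class:
  assumes N: "fclosed (witnesses E) N"
    and s: "\<And>j. j \<in> fv \<psi> - {i} \<Longrightarrow> s j \<in> N"
    and a: "holds E \<psi> (s(i := a))"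
  shows "\<exists>b\<in>N. holds E \<psi> (s(i := b))"
proof -
  obtain e where e: "e \<in> N"
    using N unfolding fclosed_def witnesses_def by (fastforce dest: bspec[of _ _ "[]"])
  obtain m where m: "\<And>j. j \<in> fv \<psi> \<Longrightarrow> j < m"
    using finite_nat_set_iff_bounded finite_fv by metis
  define xs where "xs = map (\<lambda>j. if j \<in> fv \<psi> - {i} then s j else e) [0..<m]"
  have agree: "holds E \<psi> ((list_assignment xs)(i := b)) \<longleftrightarrow> holds E \<psi> (s(i := b))" for b
    unfolding holds_def by (rule holds_rel_cong) (use m in \<open>auto simp: list_assignment_def xs_def\<close>)
  then have "holds E \<psi> (s(i := witness E \<psi> i xs))"
    using someI[of "\<lambda>b. holds E \<psi> ((list_assignment xs)(i := b))" a] a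
    unfolding witness_def by simp
  moreover have "xs \<in> lists N" using s e by (auto simp: xs_def)
  then have "witness E \<psi> i xs \<in> N"
    using N unfolding fclosed_def witnesses_def by blast
  ultimately show ?thesis by blast
qed

text \<open>
  Induction on the formula. The quantifier steps use the Tarski-Vaught condition, for the universal
  one applied to the negated body.
\<close>

lemma absolute_if_fclosed_witnesses:
  assumes N: "fclosed (witnesses E) N"
  shows "absolute_for E N \<phi>"
proof -
  have "holds_rel E N \<phi> s \<longleftrightarrow> holds E \<phi> s" if "\<And>j. j \<in> fv \<phi> \<Longrightarrow> s j \<in> N" for s
    using that
  proof (induction \<phi> arbitrary: s)
    case (All i \<phi>)
    have IH: "holds_rel E N \<phi> (s(i := a)) \<longleftrightarrow> holds E \<phi> (s(i := a))" if "a \<in> N" for a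
      by (rule All.IH) (use All.prems that in auto)
    have "(\<forall>a\<in>N. holds E \<phi> (s(i := a))) \<longleftrightarrow> (\<forall>a. holds E \<phi> (s(i := a)))"
      using witness_in_closed_class[OF N, of "Neg \<phi>" i s] All.prems by (auto simp: holds_def)
    then show ?case using IH by (simp add: holds_def)
  next
    case (Ex i \<phi>)
    have IH: "holds_rel E N \<phi> (s(i := a)) \<longleftrightarrow> holds E \<phi> (s(i := a))" if "a \<in> N" for a
      by (rule Ex.IH) (use Ex.prems that in auto)
    have "(\<exists>a\<in>N. holds E \<phi> (s(i := a))) \<longleftrightarrow> (\<exists>a. holds E \<phi> (s(i := a)))"
      using witness_in_closed_class[OF N, of \<phi> i s] Ex.prems by auto
    then show ?case using IH by (simp add: holds_def)
  next
    case (And \<phi> \<psi>)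
    show ?case using And.IH(1)[of s] And.IH(2)[of s] And.prems by (simp add: holds_def)
  next
    case (Or \<phi> \<psi>)
    show ?case using Or.IH(1)[of s] Or.IH(2)[of s] Or.prems by (simp add: holds_def)
  next
    case (Imp \<phi> \<psi>)
    show ?case using Imp.IH(1)[of s] Imp.IH(2)[of s] Imp.prems by (simp add: holds_def)
  next
    case (Iff \<phi> \<psi>)
    show ?case using Iff.IH(1)[of s] Iff.IH(2)[of s] Iff.prems by (simp add: holds_def)
  next
    case (Neg \<phi>)
    show ?case using Neg.IH[of s] Neg.prems by (simp add: holds_def)
  qed (simp_all add: holds_def)
  then show ?thesis unfolding absolute_for_def by blast
qed

section \<open>Closed hulls from rational linear combinations and supports\<close>

definition vector_ops :: "('a \<Rightarrow> 'a set) \<Rightarrow> 'a::real_vector set \<Rightarrow> 'a set" where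
  "vector_ops D T = insert 0 (\<Union>u\<in>T. D u \<union> (\<Union>v\<in>T. (\<lambda>q. q *\<^sub>R u + v) ` \<rat>))"

lemma countable_vector_ops:
  "countable T \<Longrightarrow> (\<And>u. countable (D u)) \<Longrightarrow> countable (vector_ops D T)"
  unfolding vector_ops_def by (auto simp: countable_rat)

text \<open>
  The inclusion from left to right holds because \<open>V\<close> contains the support \<open>D u\<close> of each of its
  elements \<open>u\<close>, the converse because the closure of \<open>V\<close> is a closed subspace.
\<close>

lemma closure_eq_closed_hull:
  assumes DS: "dependency_system B D"
    and V: "\<And>T. finite T \<Longrightarrow> T \<subseteq> V \<Longrightarrow> vector_ops D T \<subseteq> V"
  shows "closure V = closed_hull (V \<inter> B)"
proof
  have D: "D u \<subseteq> V \<inter> B" if "u \<in> V" for u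
    using V[of "{u}"] that DS unfolding vector_ops_def dependency_system_def by auto
  have "V \<subseteq> closed_hull (V \<inter> B)"
  proof
    fix u assume "u \<in> V"
    then show "u \<in> closed_hull (V \<inter> B)"
      using closed_hull_mono[OF D] DS unfolding dependency_system_def by blast
  qed
  then show "closure V \<subseteq> closed_hull (V \<inter> B)"
    by (intro closure_minimal closed_closed_hull)
  have "q *\<^sub>R u + v \<in> V" if "q \<in> \<rat>" "u \<in> V" "v \<in> V" for q u v
    using V[of "{u, v}"] that unfolding vector_ops_def by auto
  moreover have "0 \<in> V" using V[of "{}"] by (simp add: vector_ops_def)
  ultimately have "subspace (closure V)" by (intro subspace_closure_rational)
  then show "closed_hull (V \<inter> B) \<subseteq> closure V"
    using closure_subset by (intro closed_hull_minimal) auto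
qed

lemma separable_space_closure_countable:
  fixes V :: "'a::metric_space set"
  assumes "countable V"
  shows "separable_space (top_of_set (closure V))"
  unfolding separable_space_def using assms closure_subset[of V]
  by (intro exI[of _ V]) (auto simp: closure_of_subtopology Int_absorb1)

section \<open>The family of models\<close>

text \<open>
  The models are the countable closed \<open>N\<close> generated by \<open>core N\<close>, the set of codes of elements of
  \<open>B\<close> that belong to \<open>N\<close>. Both the model and its subspace are thus monotone functions of the core,
  and the recovery property of \<open>B\<close> and \<open>D\<close> makes the core a monotone function of the subspace.
\<close>

lemma (in zfc_universe) nice_rich_families_if_dependency_system:
  fixes pt :: "'v \<Rightarrow> 'a::banach" and B :: "'a set" and D :: "'a \<Rightarrow> 'a set"
  assumes pt: "bij_betw pt (elts E X) UNIV"
    and DS: "dependency_system B D"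
  shows "suitable_models_generate_nice_rich_families E X pt"
  unfolding suitable_models_generate_nice_rich_families_def
proof (intro allI impI)
  fix Y \<phi>s
  assume Y: "countable (elts E Y)"
  define H where "H xs = elts E Y \<union> witnesses E xs \<union> inv_into (elts E X) pt ` vector_ops D (pt ` set xs)"
    for xs
  define vec where "vec N = pt ` (elts E X \<inter> N)" for N
  define core where "core N = {v \<in> elts E X \<inter> N. pt v \<in> B}" for N
  have pt_inv: "pt (inv_into (elts E X) pt u) = u" "inv_into (elts E X) pt u \<in> elts E X" for u
    using pt by (auto simp: bij_betw_def f_inv_into_f inv_into_into)
  have inv_pt: "inv_into (elts E X) pt (pt v) = v" if "v \<in> elts E X" for v
    using pt that by (auto simp: bij_betw_def)
  have countable_H: "countable (H xs)" for xs
  proof -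
    have "countable (vector_ops D (pt ` set xs))"
      using DS by (intro countable_vector_ops) (auto simp: dependency_system_def countable_finite)
    then show ?thesis unfolding H_def by (intro countable_Un Y countable_witnesses countable_image)
  qed
  have core_subset: "core N \<subseteq> elts E X" "core N \<subseteq> N" for N by (auto simp: core_def)
  have vec_core: "pt ` core N = vec N \<inter> B" for N by (auto simp: core_def vec_def)

  have suitable: "elts E Y \<subseteq> N" "absolute_for E N \<phi>" if "fclosed H N" for N \<phi>
  proof -
    show "elts E Y \<subseteq> N" using that by (fastforce simp: fclosed_def H_def dest: bspec[of _ _ "[]"])
    have "fclosed (witnesses E) N" using that by (auto simp: fclosed_def H_def)
    then show "absolute_for E N \<phi>" by (rule absolute_if_fclosed_witnesses)
  qed
  have vec_ops: "vector_ops D T \<subseteq> vec N" if N: "fclosed H N" and T: "finite T" "T \<subseteq> vec N" for N T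
  proof -
    obtain F where F: "finite F" "F \<subseteq> elts E X \<inter> N" "T = pt ` F"
      using finite_subset_image[OF T[unfolded vec_def]] by blast
    obtain xs where xs: "set xs = F" using finite_list[OF F(1)] by blast
    then have "H xs \<subseteq> N" using N F by (auto simp: fclosed_def lists_eq_set)
    then have "inv_into (elts E X) pt ` vector_ops D T \<subseteq> elts E X \<inter> N"
      using F xs pt_inv unfolding H_def by blast
    then show ?thesis
      unfolding vec_def using pt_inv(1) by (metis (no_types, lifting) image_eqI image_subset_iff subsetI)
  qed
  have closure_vec: "closure (vec N) = closed_hull (pt ` core N)" if "fclosed H N" for N
    unfolding vec_core using closure_eq_closed_hull[OF DS] vec_ops[OF that] by blast
  have core_mono: "core M \<subseteq> core N" if "fclosed H N" "closure (vec M) \<subseteq> closure (vec N)" for M N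
  proof
    fix v assume v: "v \<in> core M"
    have "pt v \<in> vec M" using v by (auto simp: core_def vec_def)
    then have "pt v \<in> closed_hull (vec N \<inter> B)"
      using that closure_vec[OF that(1)] closure_subset[of "vec M"] vec_core by auto
    moreover have "B \<inter> closed_hull (vec N \<inter> B) \<subseteq> vec N \<inter> B"
    proof -
      have "D a \<subseteq> vec N \<inter> B" if "a \<in> vec N \<inter> B" for a
        using vec_ops[OF \<open>fclosed H N\<close>, of "{a}"] that DS
        unfolding vector_ops_def dependency_system_def by auto
      then show ?thesis
        using DS unfolding dependency_system_def by (meson Int_lower2)
    qed
    ultimately have "pt v \<in> vec N"
      using v unfolding core_def by blast
    then obtain w where "w \<in> elts E X \<inter> N" "pt v = pt w" by (auto simp: vec_def)
    moreover have "v \<in> elts E X" using v core_subset by blast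
    ultimately have "v \<in> N" using inv_pt by (metis IntD1 IntD2)
    then show "v \<in> core N" using v by (auto simp: core_def)
  qed

  \<comment> \<open>Cores consist of elements of \<open>X\<close>, so all models are subsets of the hull of \<open>X\<close>.\<close>
  have "small E (fhull H (elts E X))"
    by (intro small_fhull small_countable countable_H small_elts)
  then obtain Q where Q: "elts E Q = {m. elts E m \<subseteq> fhull H (elts E X)}"
    using small_Pow unfolding small_def by blast
  obtain \<M> where \<M>: "elts E \<M> =
      {m \<in> elts E Q. countable (elts E m) \<and> elts E m = fhull H (core (elts E m))}"
    by (rule exE[OF separation])
  have model_closed: "fclosed H (elts E m)" if "m \<in> elts E \<M>" for m
    using that fclosed_fhull[of H "core (elts E m)"] unfolding \<M> by auto
  have model_countable: "countable (elts E m)" if "m \<in> elts E \<M>" for m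
    using that unfolding \<M> by auto
  have modelI: "\<exists>m\<in>elts E \<M>. elts E m = N" if N: "countable N" "N = fhull H (core N)" for N
  proof -
    obtain m where m: "elts E m = N" using small_countable[OF N(1)] by (auto simp: small_def)
    have "N \<subseteq> fhull H (elts E X)" using N(2) fhull_mono[OF core_subset(1)] by blast
    then have "m \<in> elts E \<M>" unfolding \<M> Q using m N by auto
    then show ?thesis using m by blast
  qed
  have model_subspace_eq: "model_subspace E X pt m = closure (vec (elts E m))" for m
    by (simp add: model_subspace_def vec_def)

  have nice: "elts E m \<subseteq> elts E n \<longleftrightarrow> model_subspace E X pt m \<subseteq> model_subspace E X pt n"
    if mn: "m \<in> elts E \<M>" "n \<in> elts E \<M>" for m n
  proof
    assume "elts E m \<subseteq> elts E n"
    then show "model_subspace E X pt m \<subseteq> model_subspace E X pt n"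
      unfolding model_subspace_eq vec_def by (intro closure_mono) auto
  next
    assume "model_subspace E X pt m \<subseteq> model_subspace E X pt n"
    then have "core (elts E m) \<subseteq> core (elts E n)"
      using core_mono[OF model_closed] mn unfolding model_subspace_eq by blast
    then have "fhull H (core (elts E m)) \<subseteq> fhull H (core (elts E n))" by (rule fhull_mono)
    then show "elts E m \<subseteq> elts E n" using mn unfolding \<M> by auto
  qed

  have "rich_family (model_subspace E X pt ` elts E \<M>)"
    unfolding rich_family_def
  proof (intro conjI ballI allI impI)
    fix F assume "F \<in> model_subspace E X pt ` elts E \<M>"
    then obtain m where m: "m \<in> elts E \<M>" "F = closure (vec (elts E m))"
      using model_subspace_eq by blast
    have "countable (vec (elts E m))"
      using model_countable[OF m(1)] unfolding vec_def by blast
    then have "separable_space (top_of_set F)"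
      unfolding m(2) by (rule separable_space_closure_countable)
    moreover have "subspace F"
      unfolding m(2) closure_vec[OF model_closed[OF m(1)]] by (rule subspace_closed_hull)
    ultimately show "separable_subspace F"
      unfolding separable_subspace_def m(2) by simp
  next
    fix S :: "'a set" assume "separable_subspace S"
    then obtain U where U: "countable U" "S \<subseteq> closure U"
      unfolding separable_subspace_def separable_space_def
      by (auto simp: closure_of_subtopology)
    \<comment> \<open>The hull \<open>M0\<close> of codes for a dense subset of \<open>S\<close> need not be generated by its core; the
      submodel \<open>N\<close> generated by that core has the same core and therefore the same subspace.\<close>
    define M0 where "M0 = fhull H (inv_into (elts E X) pt ` U)"
    define N where "N = fhull H (core M0)"
    have closed: "fclosed H M0" "fclosed H N" unfolding M0_def N_def by (rule fclosed_fhull)+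
    have "N \<subseteq> M0"
      unfolding N_def using core_subset closed(1) by (intro fhull_minimal)
    moreover have "core M0 \<subseteq> N" unfolding N_def by (rule fhull_superset)
    ultimately have core_eq: "core N = core M0" by (auto simp: core_def)
    have "countable M0"
      unfolding M0_def using countable_H U(1) by (intro countable_fhull) auto
    then have "countable N" using \<open>N \<subseteq> M0\<close> countable_subset by blast
    moreover have "N = fhull H (core N)" using core_eq by (simp add: N_def)
    ultimately obtain m where m: "m \<in> elts E \<M>" "elts E m = N" using modelI by blast
    have "U \<subseteq> vec M0"
    proof
      fix u assume "u \<in> U"
      then have "inv_into (elts E X) pt u \<in> M0"
        unfolding M0_def by (intro fhull.base imageI)
      then have "pt (inv_into (elts E X) pt u) \<in> vec M0"
        unfolding vec_def using pt_inv(2)[of u] by (intro imageI IntI)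
      then show "u \<in> vec M0" by (simp only: pt_inv(1))
    qed
    then have "closure U \<subseteq> closure (vec M0)" by (rule closure_mono)
    moreover have "closure (vec M0) = closure (vec N)"
      unfolding closure_vec[OF closed(1)] closure_vec[OF closed(2)] core_eq ..
    ultimately have "S \<subseteq> model_subspace E X pt m"
      using U(2) m(2) model_subspace_eq by auto
    then show "\<exists>F\<in>model_subspace E X pt ` elts E \<M>. S \<subseteq> F" using m(1) by blast
  next
    fix F :: "nat \<Rightarrow> 'a set"
    assume inc: "incseq F" and "range F \<subseteq> model_subspace E X pt ` elts E \<M>"
    then have "\<forall>k. \<exists>m\<in>elts E \<M>. F k = model_subspace E X pt m" by blast
    then obtain m where m: "\<And>k. m k \<in> elts E \<M>" "\<And>k. F k = model_subspace E X pt (m k)"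
      by metis
    define N where "N = (\<Union>k. elts E (m k))"
    \<comment> \<open>Niceness turns the increasing subspaces into increasing models, whose union is a model.\<close>
    have inc': "incseq (\<lambda>k. elts E (m k))"
      using inc m nice unfolding incseq_def by metis
    have closed: "fclosed H N"
      unfolding N_def by (intro fclosed_UN_incseq inc' model_closed m)
    have "elts E (m k) \<subseteq> fhull H (core N)" for k
    proof -
      have "core (elts E (m k)) \<subseteq> core N" by (auto simp: core_def N_def)
      then have "fhull H (core (elts E (m k))) \<subseteq> fhull H (core N)" by (rule fhull_mono)
      then show ?thesis using m(1)[of k] unfolding \<M> by auto
    qed
    then have "N = fhull H (core N)"
      using fhull_minimal[OF core_subset(2) closed] unfolding N_def by blast
    moreover have "countable N" unfolding N_def using model_countable m(1) by blast
    ultimately obtain n where n: "n \<in> elts E \<M>" "elts E n = N" using modelI by blast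
    have "vec N = (\<Union>k. vec (elts E (m k)))" by (auto simp: vec_def N_def)
    moreover have "closure (\<Union>k. closure (vec (elts E (m k)))) = closure (\<Union>k. vec (elts E (m k)))"
    proof (rule antisym)
      show "closure (\<Union>k. closure (vec (elts E (m k)))) \<subseteq> closure (\<Union>k. vec (elts E (m k)))"
        by (intro closure_minimal closed_closure UN_least closure_mono UN_upper UNIV_I)
      show "closure (\<Union>k. vec (elts E (m k))) \<subseteq> closure (\<Union>k. closure (vec (elts E (m k))))"
        by (intro closure_mono UN_mono closure_subset) simp
    qed
    ultimately have "closure (\<Union>k. F k) = model_subspace E X pt n"
      using m(2) n(2) by (simp add: model_subspace_eq)
    then show "closure (\<Union>k. F k) \<in> model_subspace E X pt ` elts E \<M>" using n(1) by blast
  qed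
  moreover have "suitable_model E \<phi>s Y m" if "m \<in> elts E \<M>" for m
    using suitable[OF model_closed[OF that]] model_countable[OF that]
    by (auto simp: suitable_model_def)
  ultimately show "\<exists>\<M>. (\<forall>M\<in>elts E \<M>. suitable_model E \<phi>s Y M) \<and>
      rich_family (model_subspace E X pt ` elts E \<M>) \<and>
      (\<forall>M\<in>elts E \<M>. \<forall>N\<in>elts E \<M>.
         elts E M \<subseteq> elts E N \<longleftrightarrow> model_subspace E X pt M \<subseteq> model_subspace E X pt N)"
    using nice by blast
qed

theorem theorem6:
  fixes E :: "'v \<Rightarrow> 'v \<Rightarrow> bool"
    and X :: 'v
    and pt :: "'v \<Rightarrow> 'a::banach"
    and I :: "'i set"
    and x :: "'i \<Rightarrow> 'a"
  assumes "zfc_universe E"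
    and "bij_betw pt (elts E X) UNIV"
    and "fundamental_minimal_system I x \<or> has_dens TYPE('a) aleph1"
  shows "suitable_models_generate_nice_rich_families E X pt"
proof -
  interpret zfc_universe E by (fact assms(1))
  have "\<exists>B D. dependency_system (B :: 'a set) D"
    using assms(3) dependency_system_minimal_system dependency_system_dens_aleph1 by blast
  then show ?thesis
    using nice_rich_families_if_dependency_system[OF assms(2)] by blast
qed

end
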